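(* Let $T$ be a ternary $\Gamma$-semiring, and for a set $S$ let $F(S)$ be the semimodule of terms over $S$ modulo the semimodule identities. Let $U:\mathsf{SMod}_{T,\Gamma}\to\mathsf{Set}$ be the forgetful functor. For every set $S$ and every ternary $\Gamma$-semimodule $M$ over $T$, every function $\varphi:S\to U(M)$ extends uniquely to a morphism $\bar\varphi:F(S)\to M$ in $\mathsf{SMod}_{T,\Gamma}$ such that $\bar\varphi([\mathbf{s}])=\varphi(s)$ for all $s\in S$. Equivalently, $F$ is left adjoint to $U$.
   Context: Fix a commutative monoid $(\Gamma,+,0_\Gamma)$. A ternary $\Gamma$-semiring is a commutative monoid $(T,+,0)$ with a map $T\times\Gamma\times T\times\Gamma\times T\to T$, $(a,\alpha,b,\beta,c)\mapsto a\alpha b\beta c$, that is additive in each of the five slots separately, satisfies ternary associativity $(a\alpha b\beta c)\gamma d\delta e=a\alpha(b\beta c\gamma d)\delta e=a\alpha b\beta(c\gamma d\delta e)$ for all $a,b,c,d,e\in T$, $\alpha,\beta,\gamma,\delta\in\Gamma$, and satisfies $a\alpha b\beta c=0$ whenever one of $a,b,c$ is $0$ or one of $\alpha,\beta$ is $0_\Gamma$. A ternary $\Gamma$-semimodule over $T$ is a commutative monoid $(M,+,0)$ with a map $T\times\Gamma\times M\times\Gamma\times T\to M$, $(a,\alpha,m,\beta,b)\mapsto a\alpha m\beta b$, that is additive in each of the five slots separately, satisfies $a\alpha m\beta b=0$ whenever $a=0$ or $m=0$ or $b=0$ or $\alpha=0_\Gamma$ or $\beta=0_\Gamma$, and satisfies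 the compatibility law $(a\alpha b\beta c)\gamma m\delta d=a\alpha(b\beta m\gamma c)\delta d$ for all $a,b,c,d\in T$, $m\in M$, $\alpha,\beta,\gamma,\delta\in\Gamma$. A morphism $f:M\to N$ is a monoid morphism with $f(a\alpha m\beta b)=a\alpha f(m)\beta b$ for all $a,b\in T$, $\alpha,\beta\in\Gamma$, $m\in M$. The resulting category is $\mathsf{SMod}_{T,\Gamma}$. Construction of $F(S)$. The set $\mathsf{Term}_S$ of terms is defined inductively: each $s\in S$ gives a term $\mathbf{s}$; there is a constant term $\mathbf{0}$; if $t,u$ are terms then $(t\oplus u)$ is a term; if $t$ is a term and $(a,\alpha,\beta,b)\in T\times\Gamma\times\Gamma\times T$ then $(a\alpha\,t\,\beta b)$ is a term. Let $\equiv$ be the smallest equivalence relation on $\mathsf{Term}_S$ that is stable under $\oplus$ and under every operator $t\mapsto a\alpha\,t\,\beta b$ and that contains all instances of the identities making $(\mathsf{Term}_S,\oplus,\mathbf{0})$ a commutative monoid and making the operators $t\mapsto a\alpha\,t\,\beta b$ satisfy the semimodule axioms above (additivity in each of the five slots, zero stability, compatibility with ternary multiplication). Put $F(S):=\mathsf{Term}_S/{\equiv}$ with the induced operations; it is a ternary $\Gamma$-semimodule. $[t]$ denotes the class of a term $t$. *)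

theory Defs
  imports "HOL-Algebra.Group"
begin

text \<open>
  Commutative monoids are the \<^locale>\<open>comm_monoid\<close>s of HOL-Algebra, on arbitrary carrier sets. As all
  monoids here are additive, their operation and neutral element are displayed additively.
\<close>

abbreviation gadd :: "('a, 'x) monoid_scheme \<Rightarrow> 'a \<Rightarrow> 'a \<Rightarrow> 'a"  (infixl "\<oplus>\<index>" 65)
  where "x \<oplus>\<^bsub>M\<^esub> y \<equiv> mult M x y"

abbreviation gzero :: "('a, 'x) monoid_scheme \<Rightarrow> 'a"  ("\<zero>\<index>")
  where "\<zero>\<^bsub>M\<^esub> \<equiv> one M"


section \<open>Ternary Gamma-semirings and their semimodules\<close>

record ('t, 'g) ternary = "'t monoid" +
  tern :: "'t \<Rightarrow> 'g \<Rightarrow> 't \<Rightarrow> 'g \<Rightarrow> 't \<Rightarrow> 't"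

record ('m, 't, 'g) semimod = "'m monoid" +
  act :: "'t \<Rightarrow> 'g \<Rightarrow> 'm \<Rightarrow> 'g \<Rightarrow> 't \<Rightarrow> 'm"

locale ternary_gamma_semiring =
  Gamma: comm_monoid G + T: comm_monoid T
  for G :: "'g monoid" and T :: "('t, 'g) ternary" +
  assumes tern_closed:
      "\<lbrakk>a \<in> carrier T; \<alpha> \<in> carrier G; b \<in> carrier T; \<beta> \<in> carrier G; c \<in> carrier T\<rbrakk>
        \<Longrightarrow> tern T a \<alpha> b \<beta> c \<in> carrier T"
    and tern_add1:
      "\<lbrakk>a \<in> carrier T; a' \<in> carrier T; \<alpha> \<in> carrier G; b \<in> carrier T; \<beta> \<in> carrier G; c \<in> carrier T\<rbrakk>
        \<Longrightarrow> tern T (a \<oplus>\<^bsub>T\<^esub> a') \<alpha> b \<beta> c = tern T a \<alpha> b \<beta> c \<oplus>\<^bsub>T\<^esub> tern T a' \<alpha> b \<beta> c"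
    and tern_add2:
      "\<lbrakk>a \<in> carrier T; \<alpha> \<in> carrier G; \<alpha>' \<in> carrier G; b \<in> carrier T; \<beta> \<in> carrier G; c \<in> carrier T\<rbrakk>
        \<Longrightarrow> tern T a (\<alpha> \<oplus>\<^bsub>G\<^esub> \<alpha>') b \<beta> c = tern T a \<alpha> b \<beta> c \<oplus>\<^bsub>T\<^esub> tern T a \<alpha>' b \<beta> c"
    and tern_add3:
      "\<lbrakk>a \<in> carrier T; \<alpha> \<in> carrier G; b \<in> carrier T; b' \<in> carrier T; \<beta> \<in> carrier G; c \<in> carrier T\<rbrakk>
        \<Longrightarrow> tern T a \<alpha> (b \<oplus>\<^bsub>T\<^esub> b') \<beta> c = tern T a \<alpha> b \<beta> c \<oplus>\<^bsub>T\<^esub> tern T a \<alpha> b' \<beta> c"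
    and tern_add4:
      "\<lbrakk>a \<in> carrier T; \<alpha> \<in> carrier G; b \<in> carrier T; \<beta> \<in> carrier G; \<beta>' \<in> carrier G; c \<in> carrier T\<rbrakk>
        \<Longrightarrow> tern T a \<alpha> b (\<beta> \<oplus>\<^bsub>G\<^esub> \<beta>') c = tern T a \<alpha> b \<beta> c \<oplus>\<^bsub>T\<^esub> tern T a \<alpha> b \<beta>' c"
    and tern_add5:
      "\<lbrakk>a \<in> carrier T; \<alpha> \<in> carrier G; b \<in> carrier T; \<beta> \<in> carrier G; c \<in> carrier T; c' \<in> carrier T\<rbrakk>
        \<Longrightarrow> tern T a \<alpha> b \<beta> (c \<oplus>\<^bsub>T\<^esub> c') = tern T a \<alpha> b \<beta> c \<oplus>\<^bsub>T\<^esub> tern T a \<alpha> b \<beta> c'"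
    and tern_assoc12:
      "\<lbrakk>a \<in> carrier T; b \<in> carrier T; c \<in> carrier T; d \<in> carrier T; e \<in> carrier T;
        \<alpha> \<in> carrier G; \<beta> \<in> carrier G; \<gamma> \<in> carrier G; \<delta> \<in> carrier G\<rbrakk>
        \<Longrightarrow> tern T (tern T a \<alpha> b \<beta> c) \<gamma> d \<delta> e = tern T a \<alpha> (tern T b \<beta> c \<gamma> d) \<delta> e"
    and tern_assoc23:
      "\<lbrakk>a \<in> carrier T; b \<in> carrier T; c \<in> carrier T; d \<in> carrier T; e \<in> carrier T;
        \<alpha> \<in> carrier G; \<beta> \<in> carrier G; \<gamma> \<in> carrier G; \<delta> \<in> carrier G\<rbrakk>
        \<Longrightarrow> tern T a \<alpha> (tern T b \<beta> c \<gamma> d) \<delta> e = tern T a \<alpha> b \<beta> (tern T c \<gamma> d \<delta> e)"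
    and tern_zero:
      "\<lbrakk>a \<in> carrier T; \<alpha> \<in> carrier G; b \<in> carrier T; \<beta> \<in> carrier G; c \<in> carrier T;
        a = \<zero>\<^bsub>T\<^esub> \<or> b = \<zero>\<^bsub>T\<^esub> \<or> c = \<zero>\<^bsub>T\<^esub> \<or> \<alpha> = \<zero>\<^bsub>G\<^esub> \<or> \<beta> = \<zero>\<^bsub>G\<^esub>\<rbrakk>
        \<Longrightarrow> tern T a \<alpha> b \<beta> c = \<zero>\<^bsub>T\<^esub>"

locale ternary_gamma_semimodule =
  ternary_gamma_semiring G T + M: comm_monoid M
  for G :: "'g monoid" and T :: "('t, 'g) ternary" and M :: "('m, 't, 'g) semimod" +
  assumes act_closed:
      "\<lbrakk>a \<in> carrier T; \<alpha> \<in> carrier G; m \<in> carrier M; \<beta> \<in> carrier G; b \<in> carrier T\<rbrakk>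
        \<Longrightarrow> act M a \<alpha> m \<beta> b \<in> carrier M"
    and act_add1:
      "\<lbrakk>a \<in> carrier T; a' \<in> carrier T; \<alpha> \<in> carrier G; m \<in> carrier M; \<beta> \<in> carrier G; b \<in> carrier T\<rbrakk>
        \<Longrightarrow> act M (a \<oplus>\<^bsub>T\<^esub> a') \<alpha> m \<beta> b = act M a \<alpha> m \<beta> b \<oplus>\<^bsub>M\<^esub> act M a' \<alpha> m \<beta> b"
    and act_add2:
      "\<lbrakk>a \<in> carrier T; \<alpha> \<in> carrier G; \<alpha>' \<in> carrier G; m \<in> carrier M; \<beta> \<in> carrier G; b \<in> carrier T\<rbrakk>
        \<Longrightarrow> act M a (\<alpha> \<oplus>\<^bsub>G\<^esub> \<alpha>') m \<beta> b = act M a \<alpha> m \<beta> b \<oplus>\<^bsub>M\<^esub> act M a \<alpha>' m \<beta> b"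
    and act_add3:
      "\<lbrakk>a \<in> carrier T; \<alpha> \<in> carrier G; m \<in> carrier M; m' \<in> carrier M; \<beta> \<in> carrier G; b \<in> carrier T\<rbrakk>
        \<Longrightarrow> act M a \<alpha> (m \<oplus>\<^bsub>M\<^esub> m') \<beta> b = act M a \<alpha> m \<beta> b \<oplus>\<^bsub>M\<^esub> act M a \<alpha> m' \<beta> b"
    and act_add4:
      "\<lbrakk>a \<in> carrier T; \<alpha> \<in> carrier G; m \<in> carrier M; \<beta> \<in> carrier G; \<beta>' \<in> carrier G; b \<in> carrier T\<rbrakk>
        \<Longrightarrow> act M a \<alpha> m (\<beta> \<oplus>\<^bsub>G\<^esub> \<beta>') b = act M a \<alpha> m \<beta> b \<oplus>\<^bsub>M\<^esub> act M a \<alpha> m \<beta>' b"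
    and act_add5:
      "\<lbrakk>a \<in> carrier T; \<alpha> \<in> carrier G; m \<in> carrier M; \<beta> \<in> carrier G; b \<in> carrier T; b' \<in> carrier T\<rbrakk>
        \<Longrightarrow> act M a \<alpha> m \<beta> (b \<oplus>\<^bsub>T\<^esub> b') = act M a \<alpha> m \<beta> b \<oplus>\<^bsub>M\<^esub> act M a \<alpha> m \<beta> b'"
    and act_zero:
      "\<lbrakk>a \<in> carrier T; \<alpha> \<in> carrier G; m \<in> carrier M; \<beta> \<in> carrier G; b \<in> carrier T;
        a = \<zero>\<^bsub>T\<^esub> \<or> m = \<zero>\<^bsub>M\<^esub> \<or> b = \<zero>\<^bsub>T\<^esub> \<or> \<alpha> = \<zero>\<^bsub>G\<^esub> \<or> \<beta> = \<zero>\<^bsub>G\<^esub>\<rbrakk>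
        \<Longrightarrow> act M a \<alpha> m \<beta> b = \<zero>\<^bsub>M\<^esub>"
    and act_compat:
      "\<lbrakk>a \<in> carrier T; b \<in> carrier T; c \<in> carrier T; d \<in> carrier T; m \<in> carrier M;
        \<alpha> \<in> carrier G; \<beta> \<in> carrier G; \<gamma> \<in> carrier G; \<delta> \<in> carrier G\<rbrakk>
        \<Longrightarrow> act M (tern T a \<alpha> b \<beta> c) \<gamma> m \<delta> d = act M a \<alpha> (act M b \<beta> m \<gamma> c) \<delta> d"

text \<open>
  A morphism is a total HOL function, so hom-sets are made of functions that are \<^const>\<open>extensional\<close>
  on the carrier of the source: then equality of morphisms is agreement on that carrier. Identities
  are \<open>\<lambda>x \<in> A. x\<close>, and composition is \<^const>\<open>compose\<close>.
\<close>

definition smod_hom :: "'g monoid \<Rightarrow> ('t, 'g) ternary \<Rightarrow> ('m, 't, 'g) semimod \<Rightarrow> ('n, 't, 'g) semimod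
    \<Rightarrow> ('m \<Rightarrow> 'n) set" where
  "smod_hom G T M N =
    {f \<in> hom M N \<inter> extensional (carrier M).
      f \<zero>\<^bsub>M\<^esub> = \<zero>\<^bsub>N\<^esub> \<and>
      (\<forall>a \<in> carrier T. \<forall>\<alpha> \<in> carrier G. \<forall>m \<in> carrier M. \<forall>\<beta> \<in> carrier G. \<forall>b \<in> carrier T.
        f (act M a \<alpha> m \<beta> b) = act N a \<alpha> (f m) \<beta> b)}"

definition set_hom :: "'a set \<Rightarrow> 'b set \<Rightarrow> ('a \<Rightarrow> 'b) set" where
  "set_hom A B = A \<rightarrow>\<^sub>E B"


section \<open>Terms and the free semimodule\<close>

text \<open>The term written \<open>a \<alpha> t \<beta> b\<close> in the literature is \<open>TAct a \<alpha> t \<beta> b\<close>.\<close>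

datatype ('s, dead 't, dead 'g) gterm =
    Gen 's
  | TZero
  | TPlus "('s, 't, 'g) gterm" "('s, 't, 'g) gterm"
  | TAct 't 'g "('s, 't, 'g) gterm" 'g 't
  for map: gterm_map

inductive_set terms :: "'g monoid \<Rightarrow> ('t, 'g) ternary \<Rightarrow> 's set \<Rightarrow> ('s, 't, 'g) gterm set"
  for G :: "'g monoid" and T :: "('t, 'g) ternary" and S :: "'s set" where
  Gen: "s \<in> S \<Longrightarrow> Gen s \<in> terms G T S"
| Zero: "TZero \<in> terms G T S"
| Plus: "\<lbrakk>t \<in> terms G T S; u \<in> terms G T S\<rbrakk> \<Longrightarrow> TPlus t u \<in> terms G T S"
| Act: "\<lbrakk>t \<in> terms G T S; a \<in> carrier T; \<alpha> \<in> carrier G; \<beta> \<in> carrier G; b \<in> carrier T\<rbrakk>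
    \<Longrightarrow> TAct a \<alpha> t \<beta> b \<in> terms G T S"

inductive_set term_cong ::
    "'g monoid \<Rightarrow> ('t, 'g) ternary \<Rightarrow> 's set \<Rightarrow> (('s, 't, 'g) gterm \<times> ('s, 't, 'g) gterm) set"
  for G :: "'g monoid" and T :: "('t, 'g) ternary" and S :: "'s set" where
  refl: "t \<in> terms G T S \<Longrightarrow> (t, t) \<in> term_cong G T S"
| sym: "(t, u) \<in> term_cong G T S \<Longrightarrow> (u, t) \<in> term_cong G T S"
| trans: "\<lbrakk>(t, u) \<in> term_cong G T S; (u, v) \<in> term_cong G T S\<rbrakk> \<Longrightarrow> (t, v) \<in> term_cong G T S"
| stable_plus: "\<lbrakk>(t, t') \<in> term_cong G T S; (u, u') \<in> term_cong G T S\<rbrakk>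
    \<Longrightarrow> (TPlus t u, TPlus t' u') \<in> term_cong G T S"
| stable_act: "\<lbrakk>(t, t') \<in> term_cong G T S;
      a \<in> carrier T; \<alpha> \<in> carrier G; \<beta> \<in> carrier G; b \<in> carrier T\<rbrakk>
    \<Longrightarrow> (TAct a \<alpha> t \<beta> b, TAct a \<alpha> t' \<beta> b) \<in> term_cong G T S"
| plus_assoc: "\<lbrakk>t \<in> terms G T S; u \<in> terms G T S; v \<in> terms G T S\<rbrakk>
    \<Longrightarrow> (TPlus (TPlus t u) v, TPlus t (TPlus u v)) \<in> term_cong G T S"
| plus_comm: "\<lbrakk>t \<in> terms G T S; u \<in> terms G T S\<rbrakk>
    \<Longrightarrow> (TPlus t u, TPlus u t) \<in> term_cong G T S"
| plus_zero: "t \<in> terms G T S \<Longrightarrow> (TPlus TZero t, t) \<in> term_cong G T S"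
| add1: "\<lbrakk>t \<in> terms G T S;
      a \<in> carrier T; a' \<in> carrier T; \<alpha> \<in> carrier G; \<beta> \<in> carrier G; b \<in> carrier T\<rbrakk>
    \<Longrightarrow> (TAct (a \<oplus>\<^bsub>T\<^esub> a') \<alpha> t \<beta> b, TPlus (TAct a \<alpha> t \<beta> b) (TAct a' \<alpha> t \<beta> b)) \<in> term_cong G T S"
| add2: "\<lbrakk>t \<in> terms G T S;
      a \<in> carrier T; \<alpha> \<in> carrier G; \<alpha>' \<in> carrier G; \<beta> \<in> carrier G; b \<in> carrier T\<rbrakk>
    \<Longrightarrow> (TAct a (\<alpha> \<oplus>\<^bsub>G\<^esub> \<alpha>') t \<beta> b, TPlus (TAct a \<alpha> t \<beta> b) (TAct a \<alpha>' t \<beta> b)) \<in> term_cong G T S"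
| add3: "\<lbrakk>t \<in> terms G T S; u \<in> terms G T S;
      a \<in> carrier T; \<alpha> \<in> carrier G; \<beta> \<in> carrier G; b \<in> carrier T\<rbrakk>
    \<Longrightarrow> (TAct a \<alpha> (TPlus t u) \<beta> b, TPlus (TAct a \<alpha> t \<beta> b) (TAct a \<alpha> u \<beta> b)) \<in> term_cong G T S"
| add4: "\<lbrakk>t \<in> terms G T S;
      a \<in> carrier T; \<alpha> \<in> carrier G; \<beta> \<in> carrier G; \<beta>' \<in> carrier G; b \<in> carrier T\<rbrakk>
    \<Longrightarrow> (TAct a \<alpha> t (\<beta> \<oplus>\<^bsub>G\<^esub> \<beta>') b, TPlus (TAct a \<alpha> t \<beta> b) (TAct a \<alpha> t \<beta>' b)) \<in> term_cong G T S"
| add5: "\<lbrakk>t \<in> terms G T S;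
      a \<in> carrier T; \<alpha> \<in> carrier G; \<beta> \<in> carrier G; b \<in> carrier T; b' \<in> carrier T\<rbrakk>
    \<Longrightarrow> (TAct a \<alpha> t \<beta> (b \<oplus>\<^bsub>T\<^esub> b'), TPlus (TAct a \<alpha> t \<beta> b) (TAct a \<alpha> t \<beta> b')) \<in> term_cong G T S"
| zero: "\<lbrakk>t \<in> terms G T S; a \<in> carrier T; \<alpha> \<in> carrier G; \<beta> \<in> carrier G; b \<in> carrier T;
      a = \<zero>\<^bsub>T\<^esub> \<or> t = TZero \<or> b = \<zero>\<^bsub>T\<^esub> \<or> \<alpha> = \<zero>\<^bsub>G\<^esub> \<or> \<beta> = \<zero>\<^bsub>G\<^esub>\<rbrakk>
    \<Longrightarrow> (TAct a \<alpha> t \<beta> b, TZero) \<in> term_cong G T S"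
| compat: "\<lbrakk>t \<in> terms G T S;
      a \<in> carrier T; b \<in> carrier T; c \<in> carrier T; d \<in> carrier T;
      \<alpha> \<in> carrier G; \<beta> \<in> carrier G; \<gamma> \<in> carrier G; \<delta> \<in> carrier G\<rbrakk>
    \<Longrightarrow> (TAct (tern T a \<alpha> b \<beta> c) \<gamma> t \<delta> d, TAct a \<alpha> (TAct b \<beta> t \<gamma> c) \<delta> d) \<in> term_cong G T S"

definition term_class ::
    "'g monoid \<Rightarrow> ('t, 'g) ternary \<Rightarrow> 's set \<Rightarrow> ('s, 't, 'g) gterm \<Rightarrow> ('s, 't, 'g) gterm set" where
  "term_class G T S t = term_cong G T S `` {t}"

text \<open>
  The induced operations are written with unions over representatives, as usual for quotients in
  \<^theory>\<open>HOL.Equiv_Relations\<close>: by stability all the sets in such a union coincide.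
\<close>

definition free_smod ::
    "'g monoid \<Rightarrow> ('t, 'g) ternary \<Rightarrow> 's set \<Rightarrow> (('s, 't, 'g) gterm set, 't, 'g) semimod" where
  "free_smod G T S =
    \<lparr>carrier = terms G T S // term_cong G T S,
     mult = (\<lambda>X Y. \<Union>t \<in> X. \<Union>u \<in> Y. term_class G T S (TPlus t u)),
     one = term_class G T S TZero,
     act = (\<lambda>a \<alpha> X \<beta> b. \<Union>t \<in> X. term_class G T S (TAct a \<alpha> t \<beta> b))\<rparr>"


section \<open>The functors and the adjunction\<close>

text \<open>The free functor on a function \<open>g : S \<rightarrow> S'\<close> sends \<open>[t]\<close> to \<open>[t']\<close>, where \<open>t'\<close> is \<open>t\<close> with every
  generator \<open>s\<close> replaced by \<open>g s\<close>.\<close>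

definition free_smod_map ::
    "'g monoid \<Rightarrow> ('t, 'g) ternary \<Rightarrow> 's set \<Rightarrow> 'r set \<Rightarrow> ('s \<Rightarrow> 'r)
      \<Rightarrow> ('s, 't, 'g) gterm set \<Rightarrow> ('r, 't, 'g) gterm set" where
  "free_smod_map G T S S' g =
    (\<lambda>X \<in> carrier (free_smod G T S). \<Union>t \<in> X. term_class G T S' (gterm_map g t))"

definition forget :: "('m, 't, 'g) semimod \<Rightarrow> 'm set" where
  "forget M = carrier M"

definition forget_map :: "('m \<Rightarrow> 'n) \<Rightarrow> 'm \<Rightarrow> 'n" where
  "forget_map h = h"

text \<open>The map \<open>Hom(F(S), M) \<rightarrow> Hom(S, U(M))\<close>, \<open>f \<mapsto> U(f) \<circ> \<eta>\<^sub>S\<close>, with unit \<open>\<eta>\<^sub>S(s) = [s]\<close>.\<close>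

definition adjunct ::
    "'g monoid \<Rightarrow> ('t, 'g) ternary \<Rightarrow> 's set \<Rightarrow> (('s, 't, 'g) gterm set \<Rightarrow> 'm) \<Rightarrow> 's \<Rightarrow> 'm" where
  "adjunct G T S f = (\<lambda>s \<in> S. forget_map f (term_class G T S (Gen s)))"

end

theory Submission
  imports Defs
begin

text \<open>
  A function \<open>\<phi>\<close> from \<open>S\<close> to a semimodule \<open>M\<close> determines an evaluation of terms in \<open>M\<close>. As \<open>M\<close> satisfies
  the semimodule identities, congruent terms have equal values, so evaluation factors through \<open>F(S)\<close>;
  as every class is generated from the classes of generators, a morphism out of \<open>F(S)\<close> is determined
  by its values on them.
\<close>

primrec eval_gterm :: "('m, 't, 'g) semimod \<Rightarrow> ('s \<Rightarrow> 'm) \<Rightarrow> ('s, 't, 'g) gterm \<Rightarrow> 'm" where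
  "eval_gterm M \<phi> (Gen s) = \<phi> s"
| "eval_gterm M \<phi> TZero = \<zero>\<^bsub>M\<^esub>"
| "eval_gterm M \<phi> (TPlus t u) = eval_gterm M \<phi> t \<oplus>\<^bsub>M\<^esub> eval_gterm M \<phi> u"
| "eval_gterm M \<phi> (TAct a \<alpha> t \<beta> b) = act M a \<alpha> (eval_gterm M \<phi> t) \<beta> b"

text \<open>The values of the terms in a class form a singleton.\<close>

definition free_smod_lift :: "'g monoid \<Rightarrow> ('t, 'g) ternary \<Rightarrow> 's set \<Rightarrow> ('m, 't, 'g) semimod
    \<Rightarrow> ('s \<Rightarrow> 'm) \<Rightarrow> ('s, 't, 'g) gterm set \<Rightarrow> 'm" where
  "free_smod_lift G T S M \<phi> =
    (\<lambda>X \<in> carrier (free_smod G T S). the_elem (eval_gterm M \<phi> ` X))"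

section \<open>Renaming of generators in terms\<close>

lemma gterm_map_in_terms:
  assumes "t \<in> terms G T S" "g \<in> S \<rightarrow> S'"
  shows "gterm_map g t \<in> terms G T S'"
  using assms(1) by induction (use assms(2) in \<open>auto intro: terms.intros\<close>)

text \<open>The identity of S is \<open>\<lambda>s\<in>S. s\<close>, which is
  \<open>undefined\<close> off S, so it fixes a term because all generators of that term lie in S.
  The same restriction is the reason for the hypothesis in \<open>gterm_map_compose\<close>.\<close>

lemma gterm_map_restrict_id:
  assumes "t \<in> terms G T S"
  shows "gterm_map (\<lambda>s\<in>S. s) t = t"
  using assms by induction auto

lemma gterm_map_compose:
  assumes "t \<in> terms G T S"
  shows "gterm_map (compose S g' g) t = gterm_map g' (gterm_map g t)"
  using assms by induction (auto simp: compose_eq)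

text \<open>Renaming leaves scalars alone and commutes with the term constructors, so an instance of
  a rule over S becomes an instance of the same rule over S'. This makes F well defined on
  functions.\<close>

lemma term_cong_gterm_map:
  assumes "(t, u) \<in> term_cong G T S" "g \<in> S \<rightarrow> S'"
  shows "(gterm_map g t, gterm_map g u) \<in> term_cong G T S'"
  using assms(1)
proof induction
  case (sym t u)
  then show ?case by (blast intro: term_cong.sym)
next
  case (trans t u v)
  then show ?case by (blast intro: term_cong.trans)
next
  case (zero t a \<alpha> \<beta> b)
  then show ?case
    by (auto intro!: term_cong.zero gterm_map_in_terms[OF _ assms(2)])
qed (auto intro: term_cong.refl term_cong.stable_plus term_cong.stable_act term_cong.plus_assoc
    term_cong.plus_comm term_cong.plus_zero term_cong.add1 term_cong.add2 term_cong.add3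
    term_cong.add4 term_cong.add5 term_cong.compat gterm_map_in_terms[OF _ assms(2)])

section \<open>Evaluation of terms in a semimodule\<close>

lemma (in ternary_gamma_semimodule) eval_gterm_closed:
  assumes "t \<in> terms G T S" "\<phi> \<in> S \<rightarrow> carrier M"
  shows "eval_gterm M \<phi> t \<in> carrier M"
  using assms(1) by induction (use assms(2) in \<open>auto intro: act_closed\<close>)

lemma (in ternary_gamma_semimodule) eval_gterm_cong:
  assumes "(t, u) \<in> term_cong G T S" "\<phi> \<in> S \<rightarrow> carrier M"
  shows "eval_gterm M \<phi> t = eval_gterm M \<phi> u"
  using assms(1)
proof induction
  case (zero t a \<alpha> \<beta> b)
  then show ?case
    by (auto intro!: act_zero eval_gterm_closed[OF _ assms(2)])
qed (auto simp: M.m_ac act_add1 act_add2 act_add3 act_add4 act_add5 act_compat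
    eval_gterm_closed[OF _ assms(2)])

section \<open>The quotient of terms and its induced operations\<close>

context ternary_gamma_semiring
begin

text \<open>The additivity and compatibility rules form new scalars; these stay in the carriers
  because T and \<Gamma> are closed under their operations.\<close>

lemma term_cong_in_terms:
  assumes "(t, u) \<in> term_cong G T S"
  shows "t \<in> terms G T S" "u \<in> terms G T S"
proof -
  have "t \<in> terms G T S \<and> u \<in> terms G T S"
    using assms by induction (auto intro: terms.intros tern_closed)
  then show "t \<in> terms G T S" "u \<in> terms G T S" by auto
qed

lemma equiv_term_cong: "equiv (terms G T S) (term_cong G T S)"
  by (intro equivI refl_onI symI transI subrelI)
    (auto intro: term_cong.refl term_cong.sym term_cong.trans term_cong_in_terms)

lemma term_class_eqI:
  "(t, u) \<in> term_cong G T S \<Longrightarrow> term_class G T S t = term_class G T S u"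
  unfolding term_class_def by (rule equiv_class_eq[OF equiv_term_cong])

lemma term_class_in_carrier:
  "t \<in> terms G T S \<Longrightarrow> term_class G T S t \<in> carrier (free_smod G T S)"
  by (simp add: free_smod_def term_class_def quotientI)

lemma free_smod_carrierE:
  assumes "X \<in> carrier (free_smod G T S)"
  obtains t where "t \<in> terms G T S" "X = term_class G T S t"
  using assms by (auto simp: free_smod_def term_class_def elim: quotientE)

text \<open>A union of equal sets over a nonempty index set is that set, and the class of t contains
  t. With this the operations on classes can be computed on representatives.\<close>

lemma UN_term_class:
  assumes "t \<in> terms G T S" "\<And>u. (t, u) \<in> term_cong G T S \<Longrightarrow> f u = f t"
  shows "(\<Union>u \<in> term_class G T S t. f u) = f t"
  using assms by (auto simp: term_class_def intro: term_cong.refl)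

lemma free_smod_zero: "\<zero>\<^bsub>free_smod G T S\<^esub> = term_class G T S TZero"
  by (simp add: free_smod_def)

lemma free_smod_plus:
  assumes "t \<in> terms G T S" "u \<in> terms G T S"
  shows "term_class G T S t \<oplus>\<^bsub>free_smod G T S\<^esub> term_class G T S u = term_class G T S (TPlus t u)"
proof -
  \<comment> \<open>The double union collapses in two stages: first over u' for an arbitrary term
    t', then over t' with u fixed.\<close>
  have "(\<Union>u' \<in> term_class G T S u. term_class G T S (TPlus t' u')) = term_class G T S (TPlus t' u)"
    if "t' \<in> terms G T S" for t'
    using assms(2) that
    by (intro UN_term_class term_class_eqI) (auto intro: term_cong.stable_plus term_cong.intros(1,2))
  moreover have "(\<Union>t' \<in> term_class G T S t. term_class G T S (TPlus t' u)) = term_class G T S (TPlus t u)"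
    using assms
    by (intro UN_term_class term_class_eqI) (auto intro: term_cong.stable_plus term_cong.intros(1,2))
  moreover have "t' \<in> terms G T S" if "t' \<in> term_class G T S t" for t'
    using that by (auto simp: term_class_def intro: term_cong_in_terms)
  ultimately show ?thesis by (simp add: free_smod_def)
qed

lemma free_smod_act:
  assumes "t \<in> terms G T S" "a \<in> carrier T" "\<alpha> \<in> carrier G" "\<beta> \<in> carrier G" "b \<in> carrier T"
  shows "act (free_smod G T S) a \<alpha> (term_class G T S t) \<beta> b = term_class G T S (TAct a \<alpha> t \<beta> b)"
  unfolding free_smod_def using assms
  by (auto intro!: UN_term_class term_class_eqI intro: term_cong.stable_act term_cong.sym)

lemmas free_smod_ops = free_smod_zero free_smod_plus free_smod_act

section \<open>F(S) as a semimodule, and morphisms out of it\<close>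

lemma comm_monoid_free_smod: "comm_monoid (free_smod G T S)"
proof (rule comm_monoidI)
  show "X \<oplus>\<^bsub>free_smod G T S\<^esub> Y \<in> carrier (free_smod G T S)"
    if "X \<in> carrier (free_smod G T S)" "Y \<in> carrier (free_smod G T S)" for X Y
    using that by (elim free_smod_carrierE) (simp add: free_smod_ops term_class_in_carrier terms.Plus)
  show "\<zero>\<^bsub>free_smod G T S\<^esub> \<in> carrier (free_smod G T S)"
    by (simp add: free_smod_ops term_class_in_carrier terms.Zero)
  show "(X \<oplus>\<^bsub>free_smod G T S\<^esub> Y) \<oplus>\<^bsub>free_smod G T S\<^esub> Z
      = X \<oplus>\<^bsub>free_smod G T S\<^esub> (Y \<oplus>\<^bsub>free_smod G T S\<^esub> Z)"
    if "X \<in> carrier (free_smod G T S)" "Y \<in> carrier (free_smod G T S)"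
      "Z \<in> carrier (free_smod G T S)" for X Y Z
    using that
    by (elim free_smod_carrierE) (simp add: free_smod_ops terms.Plus term_class_eqI[OF term_cong.plus_assoc])
  show "\<zero>\<^bsub>free_smod G T S\<^esub> \<oplus>\<^bsub>free_smod G T S\<^esub> X = X"
    if "X \<in> carrier (free_smod G T S)" for X
    using that
    by (elim free_smod_carrierE) (simp add: free_smod_ops terms.Zero term_class_eqI[OF term_cong.plus_zero])
  show "X \<oplus>\<^bsub>free_smod G T S\<^esub> Y = Y \<oplus>\<^bsub>free_smod G T S\<^esub> X"
    if "X \<in> carrier (free_smod G T S)" "Y \<in> carrier (free_smod G T S)" for X Y
    using that
    by (elim free_smod_carrierE) (simp add: free_smod_ops term_class_eqI[OF term_cong.plus_comm])
qed

lemma semimodule_free_smod: "ternary_gamma_semimodule G T (free_smod G T S)"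
proof (intro ternary_gamma_semimodule.intro ternary_gamma_semimodule_axioms.intro)
  show "ternary_gamma_semiring G T" by (rule ternary_gamma_semiring_axioms)
  show "comm_monoid (free_smod G T S)" by (rule comm_monoid_free_smod)
next
  fix a \<alpha> X \<beta> b
  assume h: "a \<in> carrier T" "\<alpha> \<in> carrier G" "X \<in> carrier (free_smod G T S)" "\<beta> \<in> carrier G"
    "b \<in> carrier T"
  obtain t where t: "t \<in> terms G T S" "X = term_class G T S t"
    using h(3) by (rule free_smod_carrierE)
  show "act (free_smod G T S) a \<alpha> X \<beta> b \<in> carrier (free_smod G T S)"
    using h t by (simp add: free_smod_ops term_class_in_carrier terms.Act)
  assume z: "a = \<zero>\<^bsub>T\<^esub> \<or> X = \<zero>\<^bsub>free_smod G T S\<^esub> \<or> b = \<zero>\<^bsub>T\<^esub> \<or> \<alpha> = \<zero>\<^bsub>G\<^esub> \<or> \<beta> = \<zero>\<^bsub>G\<^esub>"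
  \<comment> \<open>If X is the zero class, t is only congruent to \<open>TZero\<close>, whereas the
    rule \<open>zero\<close> asks for \<open>TZero\<close> itself. In that case \<open>TZero\<close>
    is taken as representative, otherwise t.\<close>
  obtain t' where "t' \<in> terms G T S" "X = term_class G T S t'"
    "a = \<zero>\<^bsub>T\<^esub> \<or> t' = TZero \<or> b = \<zero>\<^bsub>T\<^esub> \<or> \<alpha> = \<zero>\<^bsub>G\<^esub> \<or> \<beta> = \<zero>\<^bsub>G\<^esub>"
    using z t free_smod_zero terms.Zero by metis
  then show "act (free_smod G T S) a \<alpha> X \<beta> b = \<zero>\<^bsub>free_smod G T S\<^esub>"
    using h by (simp add: free_smod_ops term_class_eqI[OF term_cong.zero])
\<comment> \<open>On representatives, each remaining axiom is an equality of classes given by the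
  rule of \<open>term_cong\<close> of the same shape.\<close>
qed (elim free_smod_carrierE; simp add: free_smod_ops terms.Plus terms.Act tern_closed
    term_class_eqI[OF term_cong.add1] term_class_eqI[OF term_cong.add2]
    term_class_eqI[OF term_cong.add3] term_class_eqI[OF term_cong.add4]
    term_class_eqI[OF term_cong.add5] term_class_eqI[OF term_cong.compat])+

text \<open>The terms on whose classes f and f' agree include the generators and are closed under
  the term constructors, so they are all terms. Off the carrier both functions are
  \<open>undefined\<close>.\<close>

lemma smod_hom_free_eqI:
  assumes f: "f \<in> smod_hom G T (free_smod G T S) M" and f': "f' \<in> smod_hom G T (free_smod G T S) M"
    and eq: "\<And>s. s \<in> S \<Longrightarrow> f (term_class G T S (Gen s)) = f' (term_class G T S (Gen s))"
  shows "f = f'"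
proof (rule extensionalityI)
  show "f \<in> extensional (carrier (free_smod G T S))" "f' \<in> extensional (carrier (free_smod G T S))"
    using f f' by (auto simp: smod_hom_def)
  have "f (term_class G T S t) = f' (term_class G T S t)" if "t \<in> terms G T S" for t
    using that
  proof induction
    case (Gen s)
    then show ?case by (rule eq)
  next
    case Zero
    \<comment> \<open>Membership in \<open>hom\<close> gives only additivity; preservation of zero
      comes from its own clause in \<open>smod_hom\<close>.\<close>
    then show ?case using f f' by (simp add: smod_hom_def flip: free_smod_zero)
  next
    case (Plus t u)
    then show ?case
      using f f' hom_mult[of f "free_smod G T S" M] hom_mult[of f' "free_smod G T S" M]
      by (simp add: smod_hom_def term_class_in_carrier flip: free_smod_plus)
  next
    case (Act t a \<alpha> \<beta> b)
    then show ?case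
      using f f' by (simp add: smod_hom_def term_class_in_carrier flip: free_smod_act)
  qed
  then show "f X = f' X" if "X \<in> carrier (free_smod G T S)" for X
    using that by (auto elim: free_smod_carrierE)
qed

section \<open>Functoriality of F, and naturality of the adjunction map\<close>

lemma free_smod_map_class:
  assumes "t \<in> terms G T S" "g \<in> S \<rightarrow> S'"
  shows "free_smod_map G T S S' g (term_class G T S t) = term_class G T S' (gterm_map g t)"
  using assms
  by (auto simp: free_smod_map_def term_class_in_carrier
      intro!: UN_term_class term_class_eqI intro: term_cong_gterm_map term_cong.sym)

lemma free_smod_map_hom:
  assumes "g \<in> S \<rightarrow> S'"
  shows "free_smod_map G T S S' g \<in> smod_hom G T (free_smod G T S) (free_smod G T S')"
proof -
  note simps = free_smod_ops free_smod_map_class[OF _ assms] gterm_map_in_terms[OF _ assms]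
    term_class_in_carrier terms.Zero terms.Plus terms.Act
  have "free_smod_map G T S S' g \<in> hom (free_smod G T S) (free_smod G T S')"
    by (rule homI; elim free_smod_carrierE; simp add: simps)
  moreover have "free_smod_map G T S S' g \<in> extensional (carrier (free_smod G T S))"
    by (simp add: free_smod_map_def)
  ultimately show ?thesis
    unfolding smod_hom_def by (auto simp: simps elim!: free_smod_carrierE)
qed

lemma free_smod_map_id:
  "free_smod_map G T S S (\<lambda>s \<in> S. s) = (\<lambda>X \<in> carrier (free_smod G T S). X)"
proof (rule extensionalityI[of _ "carrier (free_smod G T S)"])
  show "free_smod_map G T S S (\<lambda>s \<in> S. s) X = (\<lambda>X \<in> carrier (free_smod G T S). X) X"
    if "X \<in> carrier (free_smod G T S)" for X
    using that
    by (auto simp: free_smod_map_class term_class_in_carrier gterm_map_restrict_id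
        elim!: free_smod_carrierE)
qed (simp_all add: free_smod_map_def)

lemma free_smod_map_compose:
  assumes "g \<in> S \<rightarrow> S'" "g' \<in> S' \<rightarrow> S''"
  shows "free_smod_map G T S S'' (compose S g' g)
    = compose (carrier (free_smod G T S)) (free_smod_map G T S' S'' g') (free_smod_map G T S S' g)"
proof (rule extensionalityI[of _ "carrier (free_smod G T S)"])
  have "compose S g' g \<in> S \<rightarrow> S''"
    using assms by (auto simp: compose_eq)
  then show "free_smod_map G T S S'' (compose S g' g) X
      = compose (carrier (free_smod G T S)) (free_smod_map G T S' S'' g') (free_smod_map G T S S' g) X"
    if "X \<in> carrier (free_smod G T S)" for X
    using that assms
    by (auto simp: compose_eq free_smod_map_class term_class_in_carrier gterm_map_compose
        gterm_map_in_terms elim!: free_smod_carrierE)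
qed (simp_all add: free_smod_map_def)

text \<open>Both sides send s in S' to h (f [g s]), because F(g) sends [s] to [g s], and both are
  \<open>undefined\<close> off S'.\<close>

lemma adjunct_natural:
  assumes "g \<in> S' \<rightarrow> S"
  shows "adjunct G T S'
      (compose (carrier (free_smod G T S')) h
        (compose (carrier (free_smod G T S')) f (free_smod_map G T S' S g)))
    = compose S' (forget_map h) (compose S' (adjunct G T S f) g)"
  using assms
  by (auto simp: adjunct_def compose_def forget_map_def term_class_in_carrier terms.Gen
      free_smod_map_class fun_eq_iff Pi_iff restrict_def)

end

section \<open>The universal property and the adjunction bijection\<close>

context ternary_gamma_semimodule
begin

lemma free_smod_lift_class:
  assumes "t \<in> terms G T S" "\<phi> \<in> S \<rightarrow> carrier M"
  shows "free_smod_lift G T S M \<phi> (term_class G T S t) = eval_gterm M \<phi> t"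
proof -
  have "eval_gterm M \<phi> ` term_class G T S t = {eval_gterm M \<phi> t}"
    using assms term_cong.refl[OF assms(1)]
    by (auto simp: term_class_def dest: eval_gterm_cong)
  then show ?thesis
    using assms(1) by (simp add: free_smod_lift_def term_class_in_carrier)
qed

lemma free_smod_lift_hom:
  assumes "\<phi> \<in> S \<rightarrow> carrier M"
  shows "free_smod_lift G T S M \<phi> \<in> smod_hom G T (free_smod G T S) M"
proof -
  note simps = free_smod_ops free_smod_lift_class[OF _ assms] eval_gterm_closed[OF _ assms]
    terms.Zero terms.Plus terms.Act
  have "free_smod_lift G T S M \<phi> \<in> hom (free_smod G T S) M"
    by (rule homI; elim free_smod_carrierE; simp add: simps)
  moreover have "free_smod_lift G T S M \<phi> \<in> extensional (carrier (free_smod G T S))"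
    by (simp add: free_smod_lift_def)
  ultimately show ?thesis
    unfolding smod_hom_def by (auto simp: simps elim!: free_smod_carrierE)
qed

lemma free_smod_universal:
  assumes "\<phi> \<in> S \<rightarrow> carrier M"
  shows "\<exists>!f. f \<in> smod_hom G T (free_smod G T S) M
    \<and> (\<forall>s \<in> S. f (term_class G T S (Gen s)) = \<phi> s)"
proof (rule ex1I[of _ "free_smod_lift G T S M \<phi>"])
  show "free_smod_lift G T S M \<phi> \<in> smod_hom G T (free_smod G T S) M
      \<and> (\<forall>s \<in> S. free_smod_lift G T S M \<phi> (term_class G T S (Gen s)) = \<phi> s)"
    using assms by (simp add: free_smod_lift_hom free_smod_lift_class terms.Gen)
  then show "f = free_smod_lift G T S M \<phi>"
    if "f \<in> smod_hom G T (free_smod G T S) M \<and> (\<forall>s \<in> S. f (term_class G T S (Gen s)) = \<phi> s)" for f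
    using that by (intro smod_hom_free_eqI) auto
qed

text \<open>Injectivity is the uniqueness of a morphism with given values on generators. For
  surjectivity the preimage of \<phi> is its lift, which returns \<phi> restricted to S; this is
  \<phi> itself as \<phi> is extensional.\<close>

lemma adjunct_bij:
  "bij_betw (adjunct G T S) (smod_hom G T (free_smod G T S) M) (set_hom S (forget M))"
proof (rule bij_betwI')
  fix f f'
  assume f: "f \<in> smod_hom G T (free_smod G T S) M" and f': "f' \<in> smod_hom G T (free_smod G T S) M"
  have "f = f'" if "adjunct G T S f = adjunct G T S f'"
    using f f'
  proof (rule smod_hom_free_eqI)
    show "f (term_class G T S (Gen s)) = f' (term_class G T S (Gen s))" if "s \<in> S" for s
      using fun_cong[OF \<open>adjunct G T S f = adjunct G T S f'\<close>, of s] that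
      by (simp add: adjunct_def forget_map_def)
  qed
  then show "adjunct G T S f = adjunct G T S f' \<longleftrightarrow> f = f'" by auto
next
  show "adjunct G T S f \<in> set_hom S (forget M)" if "f \<in> smod_hom G T (free_smod G T S) M" for f
    using that
    by (auto simp: adjunct_def set_hom_def forget_def forget_map_def smod_hom_def
        term_class_in_carrier terms.Gen intro: hom_in_carrier)
next
  fix \<phi> assume \<phi>: "\<phi> \<in> set_hom S (forget M)"
  then have \<phi>': "\<phi> \<in> S \<rightarrow> carrier M" by (auto simp: set_hom_def forget_def)
  have "adjunct G T S (free_smod_lift G T S M \<phi>) = (\<lambda>s \<in> S. \<phi> s)"
    using \<phi>' by (auto simp: adjunct_def forget_map_def free_smod_lift_class terms.Gen)
  also have "\<dots> = \<phi>"
    using \<phi> by (simp add: set_hom_def PiE_restrict)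
  finally show "\<exists>f \<in> smod_hom G T (free_smod G T S) M. \<phi> = adjunct G T S f"
    using free_smod_lift_hom[OF \<phi>'] by metis
qed

end

theorem theorem9p4:
  fixes G :: "'g monoid" and T :: "('t, 'g) ternary"
    and S :: "'s set" and S' :: "'s1 set" and S'' :: "'s2 set"
    and M :: "('m, 't, 'g) semimod" and M' :: "('m1, 't, 'g) semimod"
    and M'' :: "('m2, 't, 'g) semimod"
  assumes "ternary_gamma_semiring G T"
    and "ternary_gamma_semimodule G T M"
    and "ternary_gamma_semimodule G T M'"
    and "ternary_gamma_semimodule G T M''"
  shows
    \<comment> \<open>the universal property of the semimodule \<open>F(S)\<close>\<close>
    "ternary_gamma_semimodule G T (free_smod G T S)
     \<and> (\<forall>\<phi> \<in> set_hom S (forget M). \<exists>!f. f \<in> smod_hom G T (free_smod G T S) M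
          \<and> (\<forall>s \<in> S. f (term_class G T S (Gen s)) = \<phi> s))
     \<and> \<comment> \<open>\<open>F\<close> is a functor\<close>
       (\<forall>g \<in> set_hom S S'.
          free_smod_map G T S S' g \<in> smod_hom G T (free_smod G T S) (free_smod G T S'))
     \<and> free_smod_map G T S S (\<lambda>s \<in> S. s) = (\<lambda>X \<in> carrier (free_smod G T S). X)
     \<and> (\<forall>g \<in> set_hom S S'. \<forall>g' \<in> set_hom S' S''.
          free_smod_map G T S S'' (compose S g' g)
          = compose (carrier (free_smod G T S))
              (free_smod_map G T S' S'' g') (free_smod_map G T S S' g))
     \<and> \<comment> \<open>\<open>U\<close> is a functor\<close>
       (\<forall>h \<in> smod_hom G T M M'. forget_map h \<in> set_hom (forget M) (forget M'))
     \<and> forget_map (\<lambda>m \<in> carrier M. m) = (\<lambda>m \<in> forget M. m)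
     \<and> (\<forall>h \<in> smod_hom G T M M'. \<forall>h' \<in> smod_hom G T M' M''.
          forget_map (compose (carrier M) h' h)
          = compose (forget M) (forget_map h') (forget_map h))
     \<and> \<comment> \<open>\<open>Hom(F(S), M) \<cong> Hom(S, U(M))\<close>, naturally in \<open>S\<close> and \<open>M\<close>\<close>
       bij_betw (adjunct G T S) (smod_hom G T (free_smod G T S) M) (set_hom S (forget M))
     \<and> (\<forall>g \<in> set_hom S' S. \<forall>h \<in> smod_hom G T M M'. \<forall>f \<in> smod_hom G T (free_smod G T S) M.
          adjunct G T S'
            (compose (carrier (free_smod G T S')) h
              (compose (carrier (free_smod G T S')) f (free_smod_map G T S' S g)))
          = compose S' (forget_map h) (compose S' (adjunct G T S f) g))"
proof -
  interpret ternary_gamma_semiring G T by (rule assms(1))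
  interpret M: ternary_gamma_semimodule G T M by (rule assms(2))
  \<comment> \<open>U leaves functions unchanged, so its identity and composition laws hold by
    unfolding. That it lands in \<open>set_hom\<close> uses the extensionality built into
    \<open>smod_hom\<close>.\<close>
  have U_hom: "forget_map h \<in> set_hom (forget M) (forget M')" if "h \<in> smod_hom G T M M'" for h
    using that by (auto simp: smod_hom_def set_hom_def forget_def forget_map_def hom_def PiE_def)
  show ?thesis
    by (intro conjI ballI semimodule_free_smod free_smod_map_id M.adjunct_bij U_hom
        free_smod_map_hom free_smod_map_compose adjunct_natural)
      (auto simp: set_hom_def forget_def forget_map_def intro!: M.free_smod_universal)
qed

end
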